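(* Let $(X,d)$ be a complete metric space, let $\kappa$ be an $e^{0}$-distance on $X$, let $\mathcal{D}_{\kappa}$ be the $e^{0}$-metric on $\mathcal{CB}(X)$ induced by $\kappa$, let $T:X\to\mathcal{CB}(X)$ be a multivalued mapping, let $\varphi:X\to X$ be a continuous self-mapping, let $\mu:[0,\infty)\to[0,1)$ be an $\mathcal{MT}$-function, and let $L\geq0$. Suppose that: (S2) $T$ satisfies one of the following conditions: (H1) $T$ is closed; (H2) the function $f:X\to[0,\infty)$ defined by $f(x)=\kappa(x,Tx)$ is lower semicontinuous; (H3) the function $g:X\to[0,\infty)$ defined by $g(x)=d(x,Tx)$ is lower semicontinuous; (H4) for any sequence $\{x_n\}$ in $X$ with $x_{n+1}\in Tx_n$ for all $n\in\mathbb{N}$ and $\lim_{n\to\infty}x_n=v$, we have $\lim_{n\to\infty}\kappa(x_n,Tv)=0$; (H5) $\inf\{\kappa(x,z)+\kappa(x,Tx):x\in X\}>0$ for every $z\in X$ with $z\notin\mathcal{F}(T)$; (S4) $Tx$ is $\varphi$-invariant (i.e. $\varphi(Tx)\subseteq Tx$) for each $x\in X$; and further that (S6) $\mathcal{D}_{\kappa}(Tx,Ty)\leq\mu(\kappa(x,y))\,\kappa(x,y)+L\,\kappa(\varphi y,Tx)$ for all $x,y\in X$. Then $\mathcal{COP}(\varphi,T)\cap\mathcal{F}(T)\neq\emptyset$.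
   Context: For a metric space $(X,d)$, $\mathcal{CB}(X)$ denotes the family of all nonempty closed and bounded subsets of $X$ (with respect to $d$). For a multivalued mapping $T$ on $X$, $\mathcal{F}(T)=\{v\in X: v\in Tv\}$ is its set of fixed points, and $T$ is closed if its graph $\{(x,y)\in X\times X:y\in Tx\}$ is closed in $X\times X$. For $\varphi:X\to X$, $\mathcal{COP}(\varphi,T)=\{x\in X:\varphi x\in Tx\}$ is the set of coincidence points of $\varphi$ and $T$. A function $\kappa:X\times X\to[0,+\infty)$ is an $e$-distance (essential distance) on $(X,d)$ if: ($\tau1$) $\kappa(x,z)\leq\kappa(x,y)+\kappa(y,z)$ for all $x,y,z\in X$; ($\tau2$) if $x\in X$ and $\{y_n\}$ is a sequence in $X$ with $\lim_{n\to\infty}y_n=y$ such that $\kappa(x,y_n)\leq M$ for all $n$, for some $M=M(x)>0$, then $\kappa(x,y)\leq M$; ($\tau3$) for any sequence $\{x_n\}$ in $X$ with $\lim_{n\to\infty}\sup\{\kappa(x_n,x_m):m>n\}=0$, if there exists a sequence $\{y_n\}$ in $X$ such that $\lim_{n\to\infty}\kappa(x_n,y_n)=0$, then $\lim_{n\to\infty}d(x_n,y_n)=0$. Limits of sequences in $X$, continuity and lower semicontinuity are with respect to $d$; $\kappa$ is not assumed symmetric. An $e^{0}$-distance is an $e$-distance $\kappa$ with $\kappa(x,x)=0$ for all $x\in X$. For $x\in X$ and nonempty $C\subseteq X$, $\kappa(x,C)=\inf_{y\in C}\kappa(x,y)$ and $d(x,C)=\inf_{y\in C}d(x,y)$. The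 function $\mathcal{D}_{\kappa}:\mathcal{CB}(X)\times\mathcal{CB}(X)\to[0,+\infty)$ (with values in $[0,+\infty)$ as part of its definition) given by $\mathcal{D}_{\kappa}(A,B)=\max\{\xi_{\kappa}(A,B),\xi_{\kappa}(B,A)\}$, where $\xi_{\kappa}(A,B)=\sup_{x\in A}\kappa(x,B)$, is called the $e^{0}$-metric on $\mathcal{CB}(X)$ induced by $\kappa$. A function $\mu:[0,\infty)\to[0,1)$ is an $\mathcal{MT}$-function if $\limsup_{s\to t^{+}}\mu(s)<1$ for all $t\in[0,\infty)$. *)

theory Defs
  imports "HOL-Analysis.Analysis"
begin

definition CB :: "'a::metric_space set set"
  where "CB = {A. A \<noteq> {} \<and> closed A \<and> bounded A}"

definition fixed_points :: "('a \<Rightarrow> 'a set) \<Rightarrow> 'a set"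
  where "fixed_points T = {v. v \<in> T v}"

definition coincidence_points :: "('a \<Rightarrow> 'a) \<Rightarrow> ('a \<Rightarrow> 'a set) \<Rightarrow> 'a set"
  where "coincidence_points \<phi> T = {x. \<phi> x \<in> T x}"

definition closed_graph :: "('a::topological_space \<Rightarrow> 'a set) \<Rightarrow> bool"
  where "closed_graph T \<longleftrightarrow> closed {(x, y). y \<in> T x}"

definition lower_semicontinuous :: "('a::topological_space \<Rightarrow> real) \<Rightarrow> bool"
  where "lower_semicontinuous f \<longleftrightarrow>
    (\<forall>x. ereal (f x) \<le> Liminf (at x) (\<lambda>y. ereal (f y)))"

(* The supremum in the third axiom is taken in the extended reals, since it may
   be infinite for some n. *)
definition e_distance :: "('a::metric_space \<Rightarrow> 'a \<Rightarrow> real) \<Rightarrow> bool"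
  where "e_distance \<kappa> \<longleftrightarrow>
    (\<forall>x y. 0 \<le> \<kappa> x y) \<and>
    (\<forall>x y z. \<kappa> x z \<le> \<kappa> x y + \<kappa> y z) \<and>
    (\<forall>x Y y M. Y \<longlonglongrightarrow> y \<and> M > 0 \<and> (\<forall>n::nat. \<kappa> x (Y n) \<le> M) \<longrightarrow> \<kappa> x y \<le> M) \<and>
    (\<forall>X Y. (\<lambda>n::nat. SUP m\<in>{n<..}. ereal (\<kappa> (X n) (X m))) \<longlonglongrightarrow> 0 \<and>
           (\<lambda>n. \<kappa> (X n) (Y n)) \<longlonglongrightarrow> 0
       \<longrightarrow> (\<lambda>n. dist (X n) (Y n)) \<longlonglongrightarrow> 0)"

definition e0_distance :: "('a::metric_space \<Rightarrow> 'a \<Rightarrow> real) \<Rightarrow> bool"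
  where "e0_distance \<kappa> \<longleftrightarrow> e_distance \<kappa> \<and> (\<forall>x. \<kappa> x x = 0)"

(* Only meaningful for C nonempty and nonnegative \<kappa>; for \<kappa> = dist it is infdist. *)
definition point_set_dist :: "('a \<Rightarrow> 'a \<Rightarrow> real) \<Rightarrow> 'a \<Rightarrow> 'a set \<Rightarrow> real"
  where "point_set_dist \<kappa> x C = (INF y\<in>C. \<kappa> x y)"

(* \<kappa> may be unbounded on sets that are bounded with respect to dist, so the excess
   and the induced e0-metric are extended-real valued; that the latter takes
   finite values on CB is the separate condition e0_metric_finite. *)
definition excess :: "('a \<Rightarrow> 'a \<Rightarrow> real) \<Rightarrow> 'a set \<Rightarrow> 'a set \<Rightarrow> ereal"
  where "excess \<kappa> A B = (SUP x\<in>A. ereal (point_set_dist \<kappa> x B))"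

definition e0_metric :: "('a \<Rightarrow> 'a \<Rightarrow> real) \<Rightarrow> 'a set \<Rightarrow> 'a set \<Rightarrow> ereal"
  where "e0_metric \<kappa> A B = max (excess \<kappa> A B) (excess \<kappa> B A)"

definition e0_metric_finite :: "('a::metric_space \<Rightarrow> 'a \<Rightarrow> real) \<Rightarrow> bool"
  where "e0_metric_finite \<kappa> \<longleftrightarrow> (\<forall>A\<in>CB. \<forall>B\<in>CB. e0_metric \<kappa> A B < \<infinity>)"

(* Functions on [0,\<infinity>) are represented by functions on real whose values at
   negative arguments are irrelevant. *)
definition MT_function :: "(real \<Rightarrow> real) \<Rightarrow> bool"
  where "MT_function \<mu> \<longleftrightarrow>
    (\<forall>t\<ge>0. 0 \<le> \<mu> t \<and> \<mu> t < 1) \<and>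
    (\<forall>t\<ge>0. Limsup (at_right t) (\<lambda>s. ereal (\<mu> s)) < 1)"

end

theory Submission
  imports Defs
begin

text \<open>
  A fixed point of \<open>T\<close> is automatically a coincidence point: if \<open>v \<in> T v\<close>, then invariance gives
  \<open>\<phi> v \<in> T v\<close>.  So only a fixed point has to be found.  Invariance also removes the perturbation
  term of the contraction condition along orbits: for \<open>y \<in> T x\<close> the point \<open>\<phi> y\<close> lies in \<open>T x\<close>, its
  \<open>\<kappa>\<close>-distance to \<open>T x\<close> is \<open>0\<close>, and what is left is the nonlinear Nadler-type condition
  \<open>\<kappa>(y, T y) \<le> \<mu>(\<kappa>(x, y)) \<kappa>(x, y)\<close>.

  Suppose that \<open>T\<close> has no fixed point.  An \<open>e\<^sup>0\<close>-distance vanishes only on the diagonal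
  (\<open>e0_distance_eq_0_imp_eq\<close>), so \<open>\<kappa>(x, y) > 0\<close> whenever \<open>y \<in> T x\<close>, and there is room between
  \<open>\<mu>(\<kappa>(x, y))\<close> and \<open>(1 + \<mu>(\<kappa>(x, y)))/2\<close> to choose an orbit \<open>x\<^sub>n\<close> of \<open>T\<close> whose steps
  \<open>t\<^sub>n = \<kappa>(x\<^sub>n, x\<^sub>n\<^sub>+\<^sub>1)\<close> satisfy \<open>t\<^sub>n\<^sub>+\<^sub>1 < (1 + \<mu>(t\<^sub>n))/2 \<cdot> t\<^sub>n\<close>.  The steps decrease strictly, so they
  approach their limit from the right, where \<open>\<mu>\<close> stays away from \<open>1\<close>: the decay is eventually
  geometric (\<open>MT_function_geometric_decay\<close>).  Hence the orbit is \<open>\<kappa>\<close>-Cauchy, which by the third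
  axiom of an \<open>e\<close>-distance makes it Cauchy.

  Its limit \<open>v\<close> satisfies \<open>\<kappa>(x\<^sub>n, v) \<longrightarrow> 0\<close> by the second axiom.  Each of the five alternative
  conditions on \<open>T\<close> now contradicts the absence of fixed points.  Those that speak of the
  \<open>\<kappa>\<close>-distance to \<open>T v\<close> use that a limit of a \<open>\<kappa>\<close>-Cauchy sequence whose \<open>\<kappa>\<close>-distance to a closed
  set tends to \<open>0\<close> belongs to that set (\<open>e_distance_limit_in_closed\<close>): for condition H4 the sequence
  is the orbit, and for H2, where semicontinuity yields \<open>\<kappa>(v, T v) = 0\<close>, it is the constant sequence
  \<open>v\<close>.  H3 is the analogue of H2 for \<open>dist\<close>, H1 is read off from the graph points
  \<open>(x\<^sub>n, x\<^sub>n\<^sub>+\<^sub>1)\<close>, and under H5 the orbit would bring the positive infimum down to \<open>0\<close>.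
\<close>

section \<open>Distance from a point to a set\<close>

lemma point_set_dist_le:
  assumes "\<And>x y. 0 \<le> \<kappa> x y" and "y \<in> C"
  shows "point_set_dist \<kappa> x C \<le> \<kappa> x y"
  unfolding point_set_dist_def using assms by (intro cINF_lower bdd_belowI[of _ 0]) auto

lemma point_set_dist_nonneg:
  assumes "\<And>x y. 0 \<le> \<kappa> x y" and "C \<noteq> {}"
  shows "0 \<le> point_set_dist \<kappa> x C"
  unfolding point_set_dist_def using assms by (intro cINF_greatest) auto

lemma point_set_dist_lessE:
  assumes "point_set_dist \<kappa> x C < b" and "C \<noteq> {}"
  obtains y where "y \<in> C" and "\<kappa> x y < b"
  using cInf_lessD[of "\<kappa> x ` C" b] assms unfolding point_set_dist_def by blast


section \<open>Essential distances\<close>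

lemma e_distance_nonneg: "e_distance \<kappa> \<Longrightarrow> 0 \<le> \<kappa> x y"
  unfolding e_distance_def by blast

lemma e_distance_triangle: "e_distance \<kappa> \<Longrightarrow> \<kappa> x z \<le> \<kappa> x y + \<kappa> y z"
  unfolding e_distance_def by blast

lemma e_distance_limit_le:
  assumes "e_distance \<kappa>" and "Y \<longlonglongrightarrow> y" and "M > 0" and "\<And>n::nat. \<kappa> x (Y n) \<le> M"
  shows "\<kappa> x y \<le> M"
  using assms unfolding e_distance_def by blast

text \<open>The third axiom with a real null sequence \<open>b\<close> in place of the extended-real supremum of the
  tail; in this form an explicit estimate of the tail can be plugged in.\<close>

lemma e_distance_dist_tendsto_0:
  assumes e: "e_distance \<kappa>"
    and b: "b \<longlonglongrightarrow> 0"
    and tail: "\<forall>\<^sub>F n in sequentially. \<forall>m>n. \<kappa> (X n) (X m) \<le> b n"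
    and Y: "(\<lambda>n. \<kappa> (X n) (Y n)) \<longlonglongrightarrow> 0"
  shows "(\<lambda>n. dist (X n) (Y n)) \<longlonglongrightarrow> 0"
proof -
  have "(\<lambda>n. SUP m\<in>{n<..}. ereal (\<kappa> (X n) (X m))) \<longlonglongrightarrow> 0"
  proof (rule tendsto_sandwich)
    show "\<forall>\<^sub>F n in sequentially. (0::ereal) \<le> (SUP m\<in>{n<..}. ereal (\<kappa> (X n) (X m)))"
    proof (rule always_eventually, rule allI)
      fix n
      show "(0::ereal) \<le> (SUP m\<in>{n<..}. ereal (\<kappa> (X n) (X m)))"
        by (rule SUP_upper2[of "Suc n"]) (auto simp: e_distance_nonneg[OF e])
    qed
    show "\<forall>\<^sub>F n in sequentially. (SUP m\<in>{n<..}. ereal (\<kappa> (X n) (X m))) \<le> ereal (b n)"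
      using tail by eventually_elim (auto intro: SUP_least)
    show "(\<lambda>n. ereal (b n)) \<longlonglongrightarrow> 0"
      using b by (simp add: zero_ereal_def)
  qed simp
  with e Y show ?thesis
    unfolding e_distance_def by blast
qed

text \<open>If the sequence were not Cauchy, infinitely many of its terms would have a far-away later
  term.  Pairing each term with such a later term contradicts the third axiom, since the
  \<open>\<kappa>\<close>-distances to all later terms tend to \<open>0\<close>.\<close>

lemma e_distance_Cauchy:
  fixes X :: "nat \<Rightarrow> 'a::metric_space"
  assumes e: "e_distance \<kappa>"
    and b: "b \<longlonglongrightarrow> 0"
    and tail: "\<forall>\<^sub>F n in sequentially. \<forall>m>n. \<kappa> (X n) (X m) \<le> b n"
  shows "Cauchy X"
proof (rule metric_CauchyI)
  fix \<epsilon> :: real assume "\<epsilon> > 0"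
  define j where "j n = (if \<exists>m>n. dist (X n) (X m) \<ge> \<epsilon>
      then SOME m. m > n \<and> dist (X n) (X m) \<ge> \<epsilon> else Suc n)" for n
  have j: "j n > n \<and> ((\<exists>m>n. dist (X n) (X m) \<ge> \<epsilon>) \<longrightarrow> dist (X n) (X (j n)) \<ge> \<epsilon>)" for n
  proof (cases "\<exists>m>n. dist (X n) (X m) \<ge> \<epsilon>")
    case True
    then have "j n > n \<and> dist (X n) (X (j n)) \<ge> \<epsilon>"
      unfolding j_def by (simp add: someI_ex[OF True])
    then show ?thesis by blast
  next
    case False
    then show ?thesis
      using j_def[of n] by (metis lessI)
  qed
  have "(\<lambda>n. \<kappa> (X n) (X (j n))) \<longlonglongrightarrow> 0"
  proof (rule tendsto_sandwich[OF _ _ tendsto_const b])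
    show "\<forall>\<^sub>F n in sequentially. 0 \<le> \<kappa> (X n) (X (j n))"
      using e_distance_nonneg[OF e] by simp
    show "\<forall>\<^sub>F n in sequentially. \<kappa> (X n) (X (j n)) \<le> b n"
      using tail by eventually_elim (use j in blast)
  qed
  then have "(\<lambda>n. dist (X n) (X (j n))) \<longlonglongrightarrow> 0"
    by (rule e_distance_dist_tendsto_0[OF e b tail])
  then have "\<forall>\<^sub>F n in sequentially. dist (X n) (X (j n)) < \<epsilon>"
    using \<open>\<epsilon> > 0\<close> by (rule order_tendstoD(2))
  then obtain N where N: "\<And>n. n \<ge> N \<Longrightarrow> dist (X n) (X (j n)) < \<epsilon>"
    unfolding eventually_sequentially by blast
  have later: "dist (X n) (X m) < \<epsilon>" if "n \<ge> N" "m > n" for n m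
    using N[OF that(1)] j[of n] that(2) by (meson not_less)
  have "dist (X m) (X n) < \<epsilon>" if "m \<ge> N" "n \<ge> N" for m n
    using later[of m n] later[of n m] that \<open>\<epsilon> > 0\<close>
    by (cases m n rule: linorder_cases) (auto simp: dist_commute)
  then show "\<exists>N. \<forall>m\<ge>N. \<forall>n\<ge>N. dist (X m) (X n) < \<epsilon>"
    by blast
qed

text \<open>Points of \<open>C\<close> that nearly realise \<open>\<kappa>(X n, C)\<close> are \<open>dist\<close>-close to \<open>X n\<close> by the third axiom,
  so they converge to the same limit.\<close>

lemma e_distance_limit_in_closed:
  fixes X :: "nat \<Rightarrow> 'a::metric_space"
  assumes e: "e_distance \<kappa>"
    and b: "b \<longlonglongrightarrow> 0"
    and tail: "\<forall>\<^sub>F n in sequentially. \<forall>m>n. \<kappa> (X n) (X m) \<le> b n"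
    and X: "X \<longlonglongrightarrow> v"
    and C: "closed C" "C \<noteq> {}"
    and lim: "(\<lambda>n. point_set_dist \<kappa> (X n) C) \<longlonglongrightarrow> 0"
  shows "v \<in> C"
proof -
  have "\<exists>y. y \<in> C \<and> \<kappa> (X n) y < point_set_dist \<kappa> (X n) C + inverse (real (Suc n))" for n
    by (rule point_set_dist_lessE[of \<kappa> "X n" C, OF _ C(2)]) auto
  then obtain Y where Y: "\<And>n. Y n \<in> C"
      "\<And>n. \<kappa> (X n) (Y n) < point_set_dist \<kappa> (X n) C + inverse (real (Suc n))"
    by metis
  have "(\<lambda>n. \<kappa> (X n) (Y n)) \<longlonglongrightarrow> 0"
  proof (rule tendsto_sandwich[OF _ _ tendsto_const])
    show "\<forall>\<^sub>F n in sequentially. 0 \<le> \<kappa> (X n) (Y n)"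
      using e_distance_nonneg[OF e] by simp
    show "\<forall>\<^sub>F n in sequentially.
        \<kappa> (X n) (Y n) \<le> point_set_dist \<kappa> (X n) C + inverse (real (Suc n))"
      using Y(2) by (simp add: less_imp_le)
    show "(\<lambda>n. point_set_dist \<kappa> (X n) C + inverse (real (Suc n))) \<longlonglongrightarrow> 0"
      using tendsto_add[OF lim LIMSEQ_inverse_real_of_nat] by simp
  qed
  then have "(\<lambda>n. dist (X n) (Y n)) \<longlonglongrightarrow> 0"
    by (rule e_distance_dist_tendsto_0[OF e b tail])
  then have "(\<lambda>n. dist (X n) (Y n) + dist (X n) v) \<longlonglongrightarrow> 0"
    using tendsto_dist_iff[THEN iffD1, OF X] by (rule tendsto_add_zero)
  then have "(\<lambda>n. dist (Y n) v) \<longlonglongrightarrow> 0"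
    by (rule tendsto_sandwich[OF _ _ tendsto_const, rotated -1])
       (auto simp: dist_triangle3)
  then have "Y \<longlonglongrightarrow> v"
    by (rule tendsto_dist_iff[THEN iffD2])
  then show ?thesis
    using C(1) Y(1) by (rule closed_sequentially[rotated 2])
qed

text \<open>Because \<open>\<kappa> x x = 0\<close>, the constant sequence \<open>x\<close> is \<open>\<kappa>\<close>-Cauchy.\<close>

lemma e0_distance_point_set_dist_eq_0_imp_mem:
  assumes e0: "e0_distance \<kappa>"
    and C: "closed C" "C \<noteq> {}"
    and "point_set_dist \<kappa> x C = 0"
  shows "x \<in> C"
proof (rule e_distance_limit_in_closed)
  show "e_distance \<kappa>"
    using e0 by (simp add: e0_distance_def)
  show "\<forall>\<^sub>F n in sequentially. \<forall>m>n. \<kappa> x x \<le> 0"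
    using e0 by (simp add: e0_distance_def)
qed (use assms in auto)

lemma e0_distance_eq_0_imp_eq:
  assumes "e0_distance \<kappa>" and "\<kappa> x y = 0"
  shows "x = y"
  using e0_distance_point_set_dist_eq_0_imp_mem[of \<kappa> "{y}" x] assms by (simp add: point_set_dist_def)


section \<open>Lower semicontinuity\<close>

text \<open>The lower limit runs over punctured neighbourhoods of \<open>v\<close>, but the sequence may visit \<open>v\<close>;
  the strict bound \<open>a < f v\<close> holds at \<open>v\<close> as well, so this does no harm.\<close>

lemma lower_semicontinuous_le_limit:
  assumes lsc: "lower_semicontinuous f"
    and X: "X \<longlonglongrightarrow> v"
    and le: "\<And>n::nat. f (X n) \<le> b n"
    and b: "b \<longlonglongrightarrow> c"
  shows "f v \<le> c"
proof (rule ccontr)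
  assume "\<not> f v \<le> c"
  then obtain a where a: "c < a" "a < f v"
    using dense[of c "f v"] by auto
  have "ereal a < Liminf (at v) (\<lambda>y. ereal (f y))"
    using lsc a(2) unfolding lower_semicontinuous_def
    by (meson less_ereal.simps(1) less_le_trans)
  then have "\<forall>\<^sub>F y in at v. a < f y"
    using less_LiminfD[of "ereal a" "at v" "\<lambda>y. ereal (f y)"] by simp
  then have "\<forall>\<^sub>F y in nhds v. a < f y"
    using a(2) by (auto simp: eventually_at_filter elim: eventually_mono)
  then have "\<forall>\<^sub>F n in sequentially. a < f (X n)"
    using X by (auto simp: filterlim_iff)
  moreover have "\<forall>\<^sub>F n in sequentially. b n < a"
    using b a(1) by (rule order_tendstoD(2))
  ultimately have "\<forall>\<^sub>F n in sequentially. a < f (X n) \<and> b n < a"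
    by (rule eventually_conj)
  then obtain n where "a < f (X n)" "b n < a"
    using eventually_happens by force
  with le[of n] show False
    by simp
qed


section \<open>Decay and summability along an orbit\<close>

text \<open>A strictly decreasing sequence approaches its limit from the right, where an
  \<open>\<M>\<T>\<close>-function is bounded by some \<open>c < 1\<close>.  From then on the ratios are at most \<open>(1 + c)/2\<close>.\<close>

lemma MT_function_geometric_decay:
  fixes t :: "nat \<Rightarrow> real"
  assumes mu: "MT_function \<mu>"
    and pos: "\<And>n. t n > 0"
    and step: "\<And>n. t (Suc n) < (1 + \<mu> (t n)) / 2 * t n"
  obtains \<gamma> N where "\<gamma> < 1" and "\<And>n. n \<ge> N \<Longrightarrow> t (Suc n) \<le> \<gamma> * t n" and "t \<longlonglongrightarrow> 0"
proof -
  have dec: "t (Suc n) < t n" for n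
  proof -
    have "\<mu> (t n) < 1"
      using mu pos[of n] unfolding MT_function_def by simp
    then have "(1 + \<mu> (t n)) / 2 * t n \<le> 1 * t n"
      using pos[of n] by (intro mult_right_mono) auto
    with step[of n] show ?thesis by simp
  qed
  then have "decseq t"
    by (simp add: decseq_Suc_iff less_imp_le)
  then obtain a where a: "t \<longlonglongrightarrow> a" "\<And>n. a \<le> t n"
    using decseq_convergent[of t 0] pos by (metis less_imp_le)
  have above: "a < t n" for n
    using a(2)[of "Suc n"] dec[of n] by simp
  have a0: "a \<ge> 0"
    using a(1) pos by (intro LIMSEQ_le_const) (auto intro: less_imp_le)
  then have "Limsup (at_right a) (\<lambda>s. ereal (\<mu> s)) < 1"
    using mu unfolding MT_function_def by blast
  then obtain c where c: "Limsup (at_right a) (\<lambda>s. ereal (\<mu> s)) < ereal c" "c < 1"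
    using ereal_dense2[of _ 1] by (metis less_ereal.simps(1) one_ereal_def)
  have "\<forall>\<^sub>F s in at_right a. \<mu> s < c"
    using Limsup_lessD[OF c(1)] by simp
  moreover have "filterlim t (at_right a) sequentially"
    using a(1) above by (simp add: tendsto_imp_filterlim_at_right)
  ultimately have "\<forall>\<^sub>F n in sequentially. \<mu> (t n) < c"
    by (rule eventually_compose_filterlim)
  then obtain N where N: "\<And>n. n \<ge> N \<Longrightarrow> \<mu> (t n) < c"
    unfolding eventually_sequentially by blast
  define \<gamma> where "\<gamma> = (1 + c) / 2"
  have \<gamma>: "\<gamma> < 1"
    using c(2) by (simp add: \<gamma>_def)
  have geo: "t (Suc n) \<le> \<gamma> * t n" if "n \<ge> N" for n
  proof -
    have "(1 + \<mu> (t n)) / 2 * t n \<le> \<gamma> * t n"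
      using N[OF that] pos[of n] by (intro mult_right_mono) (auto simp: \<gamma>_def)
    with step[of n] show ?thesis by simp
  qed
  have "a \<le> \<gamma> * a"
  proof (rule LIMSEQ_le)
    show "(\<lambda>n. t (Suc n)) \<longlonglongrightarrow> a"
      using a(1) by (rule LIMSEQ_Suc)
    show "(\<lambda>n. \<gamma> * t n) \<longlonglongrightarrow> \<gamma> * a"
      using a(1) by (rule tendsto_mult_left)
    show "\<exists>N. \<forall>n\<ge>N. t (Suc n) \<le> \<gamma> * t n"
      using geo by blast
  qed
  then have "(1 - \<gamma>) * a \<le> 0"
    by (simp add: algebra_simps)
  then have "a = 0"
    using \<gamma> a0 by (simp add: mult_le_0_iff)
  with a(1) \<gamma> geo that show ?thesis
    by blast
qed

text \<open>Geometric decay makes the step lengths telescope: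
  \<open>(1 - \<gamma>) t\<^sub>k \<le> t\<^sub>k - t\<^sub>k\<^sub>+\<^sub>1\<close>, and these bounds add up to \<open>t\<^sub>n - t\<^sub>n\<^sub>+\<^sub>k\<close>.\<close>

lemma e0_distance_geometric_tail:
  assumes e0: "e0_distance \<kappa>"
    and \<gamma>: "\<gamma> < 1"
    and geo: "\<And>n. n \<ge> N \<Longrightarrow> \<kappa> (X (Suc n)) (X (Suc (Suc n))) \<le> \<gamma> * \<kappa> (X n) (X (Suc n))"
    and "N \<le> n" "n < m"
  shows "\<kappa> (X n) (X m) \<le> \<kappa> (X n) (X (Suc n)) / (1 - \<gamma>)"
proof -
  let ?t = "\<lambda>n. \<kappa> (X n) (X (Suc n))"
  have e: "e_distance \<kappa>" and refl: "\<And>x. \<kappa> x x = 0"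
    using e0 by (auto simp: e0_distance_def)
  have "(1 - \<gamma>) * \<kappa> (X n) (X (n + k)) \<le> ?t n - ?t (n + k)" for k
  proof (induction k)
    case 0
    then show ?case by (simp add: refl)
  next
    case (Suc k)
    have "(1 - \<gamma>) * \<kappa> (X n) (X (n + Suc k)) \<le> (1 - \<gamma>) * (\<kappa> (X n) (X (n + k)) + ?t (n + k))"
      using \<gamma> e_distance_triangle[OF e, of "X n" "X (Suc (n + k))" "X (n + k)"]
      by (intro mult_left_mono) auto
    also have "\<dots> \<le> ?t n - \<gamma> * ?t (n + k)"
      using Suc.IH by (simp add: algebra_simps)
    also have "\<dots> \<le> ?t n - ?t (n + Suc k)"
      using geo[of "n + k"] \<open>N \<le> n\<close> by simp
    finally show ?case .
  qed
  from this[of "m - n"] have "(1 - \<gamma>) * \<kappa> (X n) (X m) \<le> ?t n"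
    using \<open>n < m\<close> e_distance_nonneg[OF e, of "X m" "X (Suc m)"] by simp
  then show ?thesis
    using \<gamma> by (simp add: pos_le_divide_eq mult.commute)
qed


section \<open>The fixed point\<close>

text \<open>The hypothesis that \<open>T\<close> has no fixed point keeps all steps of the orbit positive, which the
  strict choice of the next point and the bound \<open>M > 0\<close> in the second axiom of an \<open>e\<close>-distance both
  require.  The tail estimate \<open>b\<close> is part of the conclusion because the membership criterion above
  asks for a \<open>\<kappa>\<close>-Cauchy sequence.\<close>

lemma MT_contractive_orbit_convergent:
  fixes \<kappa> :: "'a::complete_space \<Rightarrow> 'a \<Rightarrow> real"
  assumes e0: "e0_distance \<kappa>"
    and ne: "\<And>x. T x \<noteq> {}"
    and mu: "MT_function \<mu>"
    and contr: "\<And>x y. y \<in> T x \<Longrightarrow> point_set_dist \<kappa> y (T y) \<le> \<mu> (\<kappa> x y) * \<kappa> x y"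
    and nofix: "\<And>x. x \<notin> T x"
  obtains X b v where "\<And>n::nat. X (Suc n) \<in> T (X n)" and "X \<longlonglongrightarrow> v"
    and "(\<lambda>n. \<kappa> (X n) (X (Suc n))) \<longlonglongrightarrow> 0"
    and "b \<longlonglongrightarrow> 0" and "\<forall>\<^sub>F n in sequentially. \<forall>m>n. \<kappa> (X n) (X m) \<le> b n"
    and "(\<lambda>n. \<kappa> (X n) v) \<longlonglongrightarrow> 0"
proof -
  have e: "e_distance \<kappa>"
    using e0 by (simp add: e0_distance_def)
  have pos: "\<kappa> x y > 0" if "y \<in> T x" for x y
    using e0_distance_eq_0_imp_eq[OF e0, of x y] e_distance_nonneg[OF e, of x y] nofix[of x] that
    by (metis order_less_le)
  have next_point: "\<exists>z\<in>T y. \<kappa> y z < (1 + \<mu> (\<kappa> x y)) / 2 * \<kappa> x y" if "y \<in> T x" for x y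
  proof -
    have "\<mu> (\<kappa> x y) < 1"
      using mu pos[OF that] unfolding MT_function_def by simp
    then have "\<mu> (\<kappa> x y) * \<kappa> x y < (1 + \<mu> (\<kappa> x y)) / 2 * \<kappa> x y"
      using pos[OF that] by (intro mult_strict_right_mono) auto
    with contr[OF that] have "point_set_dist \<kappa> y (T y) < (1 + \<mu> (\<kappa> x y)) / 2 * \<kappa> x y"
      by simp
    then show ?thesis
      using ne by (rule point_set_dist_lessE) blast
  qed
  \<comment> \<open>The choice of the next point depends on the last two, so the recursion runs on pairs.\<close>
  have "\<exists>Z. \<forall>n::nat. snd (Z n) \<in> T (fst (Z n)) \<and> fst (Z (Suc n)) = snd (Z n) \<and>
      \<kappa> (fst (Z (Suc n))) (snd (Z (Suc n)))
        < (1 + \<mu> (\<kappa> (fst (Z n)) (snd (Z n)))) / 2 * \<kappa> (fst (Z n)) (snd (Z n))"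
  proof (rule dependent_nat_choice)
    show "\<exists>p. snd p \<in> T (fst p)"
      using ne by fastforce
  next
    fix p :: "'a \<times> 'a" and n :: nat
    assume "snd p \<in> T (fst p)"
    from next_point[OF this] obtain z where "z \<in> T (snd p)"
        "\<kappa> (snd p) z < (1 + \<mu> (\<kappa> (fst p) (snd p))) / 2 * \<kappa> (fst p) (snd p)"
      by blast
    then show "\<exists>q. snd q \<in> T (fst q) \<and> fst q = snd p \<and>
        \<kappa> (fst q) (snd q) < (1 + \<mu> (\<kappa> (fst p) (snd p))) / 2 * \<kappa> (fst p) (snd p)"
      by (intro exI[of _ "(snd p, z)"]) simp
  qed
  then obtain Z where Z: "\<And>n::nat. snd (Z n) \<in> T (fst (Z n))" "\<And>n. fst (Z (Suc n)) = snd (Z n)"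
      "\<And>n. \<kappa> (fst (Z (Suc n))) (snd (Z (Suc n)))
        < (1 + \<mu> (\<kappa> (fst (Z n)) (snd (Z n)))) / 2 * \<kappa> (fst (Z n)) (snd (Z n))"
    by blast
  define X where "X n = fst (Z n)" for n
  let ?t = "\<lambda>n. \<kappa> (X n) (X (Suc n))"
  have orbit: "X (Suc n) \<in> T (X n)" for n
    using Z(1,2) by (simp add: X_def)
  have "?t (Suc n) < (1 + \<mu> (?t n)) / 2 * ?t n" for n
    using Z(2,3) by (simp add: X_def)
  then obtain \<gamma> N where \<gamma>: "\<gamma> < 1" and geo: "\<And>n. n \<ge> N \<Longrightarrow> ?t (Suc n) \<le> \<gamma> * ?t n"
      and t0: "?t \<longlonglongrightarrow> 0"
    using MT_function_geometric_decay[OF mu, of ?t] pos[OF orbit] by blast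
  define b where "b n = ?t n / (1 - \<gamma>)" for n
  have b0: "b \<longlonglongrightarrow> 0"
    unfolding b_def using t0 by (rule tendsto_divide_zero)
  have tail: "\<kappa> (X n) (X m) \<le> b n" if "n \<ge> N" "n < m" for n m
    unfolding b_def using e0_distance_geometric_tail[OF e0 \<gamma>, of N X, OF geo that] by simp
  then have ev_tail: "\<forall>\<^sub>F n in sequentially. \<forall>m>n. \<kappa> (X n) (X m) \<le> b n"
    unfolding eventually_sequentially by blast
  then have "Cauchy X"
    by (rule e_distance_Cauchy[OF e b0])
  then obtain v where v: "X \<longlonglongrightarrow> v"
    using Cauchy_convergent_iff convergentD by blast
  have "\<kappa> (X n) v \<le> b n" if "n \<ge> N" for n
  proof (rule e_distance_limit_le[OF e])
    show "(\<lambda>k. X (k + Suc n)) \<longlonglongrightarrow> v"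
      using v by (rule LIMSEQ_ignore_initial_segment)
    show "b n > 0"
      using pos[OF orbit[of n]] \<gamma> by (simp add: b_def)
    show "\<kappa> (X n) (X (k + Suc n)) \<le> b n" for k
      using tail[OF that] by simp
  qed
  then have "\<forall>\<^sub>F n in sequentially. \<kappa> (X n) v \<le> b n"
    unfolding eventually_sequentially by blast
  then have "(\<lambda>n. \<kappa> (X n) v) \<longlonglongrightarrow> 0"
    using e_distance_nonneg[OF e] by (intro tendsto_sandwich[OF _ _ tendsto_const b0]) auto
  with that orbit v t0 b0 ev_tail show ?thesis
    by blast
qed

theorem theorem2p4:
  fixes \<kappa> :: "'a::complete_space \<Rightarrow> 'a \<Rightarrow> real"
    and T :: "'a \<Rightarrow> 'a set"
    and \<phi> :: "'a \<Rightarrow> 'a"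
    and \<mu> :: "real \<Rightarrow> real"
    and L :: real
  assumes kappa: "e0_distance \<kappa>"
    and D_finite: "e0_metric_finite \<kappa>"
    and T: "\<And>x. T x \<in> CB"
    and phi: "continuous_on UNIV \<phi>"
    and mu: "MT_function \<mu>"
    and L: "L \<ge> 0"
    and S2:
      "closed_graph T \<or>
       lower_semicontinuous (\<lambda>x. point_set_dist \<kappa> x (T x)) \<or>
       lower_semicontinuous (\<lambda>x. infdist x (T x)) \<or>
       (\<forall>X v. (\<forall>n::nat. X (Suc n) \<in> T (X n)) \<and> X \<longlonglongrightarrow> v \<longrightarrow>
          (\<lambda>n. point_set_dist \<kappa> (X n) (T v)) \<longlonglongrightarrow> 0) \<or>
       (\<forall>z. z \<notin> fixed_points T \<longrightarrow>
          (INF x. \<kappa> x z + point_set_dist \<kappa> x (T x)) > 0)"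
    and S4: "\<And>x. \<phi> ` T x \<subseteq> T x"
    and S6: "\<And>x y. e0_metric \<kappa> (T x) (T y)
               \<le> ereal (\<mu> (\<kappa> x y) * \<kappa> x y + L * point_set_dist \<kappa> (\<phi> y) (T x))"
  shows "coincidence_points \<phi> T \<inter> fixed_points T \<noteq> {}"
proof -
  have e: "e_distance \<kappa>" and refl: "\<And>x. \<kappa> x x = 0"
    using kappa by (auto simp: e0_distance_def)
  note nonneg = e_distance_nonneg[OF e]
  have closed_T: "closed (T x)" and ne: "T x \<noteq> {}" for x
    using T[of x] by (auto simp: CB_def)
  have contr: "point_set_dist \<kappa> y (T y) \<le> \<mu> (\<kappa> x y) * \<kappa> x y" if "y \<in> T x" for x y
  proof -
    have "\<phi> y \<in> T x"
      using S4[of x] that by blast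
    then have "point_set_dist \<kappa> (\<phi> y) (T x) = 0"
      using point_set_dist_le[of \<kappa> "\<phi> y" "T x" "\<phi> y", OF nonneg]
        point_set_dist_nonneg[of \<kappa> "T x" "\<phi> y", OF nonneg ne] refl[of "\<phi> y"] by simp
    then have "e0_metric \<kappa> (T x) (T y) \<le> ereal (\<mu> (\<kappa> x y) * \<kappa> x y)"
      using S6[of x y] by simp
    moreover have "ereal (point_set_dist \<kappa> y (T y)) \<le> e0_metric \<kappa> (T x) (T y)"
      unfolding e0_metric_def excess_def
      using that by (intro max.coboundedI1 SUP_upper)
    ultimately show ?thesis
      by (metis ereal_less_eq(3) order_trans)
  qed
  have "\<exists>v. v \<in> T v"
  proof (rule ccontr)
    assume "\<not> ?thesis"
    then have nofix: "\<And>x. x \<notin> T x"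
      by blast
    obtain X b v where orbit: "\<And>n. X (Suc n) \<in> T (X n)" and v: "X \<longlonglongrightarrow> v"
        and t0: "(\<lambda>n. \<kappa> (X n) (X (Suc n))) \<longlonglongrightarrow> 0"
        and b0: "b \<longlonglongrightarrow> 0" and tail: "\<forall>\<^sub>F n in sequentially. \<forall>m>n. \<kappa> (X n) (X m) \<le> b n"
        and Xv: "(\<lambda>n. \<kappa> (X n) v) \<longlonglongrightarrow> 0"
      by (rule MT_contractive_orbit_convergent[OF kappa ne mu contr nofix]) (assumption, rule that)
    have step: "point_set_dist \<kappa> (X n) (T (X n)) \<le> \<kappa> (X n) (X (Suc n))" for n
      by (rule point_set_dist_le[OF nonneg orbit])
    from S2 consider
        (H1) "closed_graph T"
      | (H2) "lower_semicontinuous (\<lambda>x. point_set_dist \<kappa> x (T x))"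
      | (H3) "lower_semicontinuous (\<lambda>x. infdist x (T x))"
      | (H4) "\<forall>X v. (\<forall>n::nat. X (Suc n) \<in> T (X n)) \<and> X \<longlonglongrightarrow> v \<longrightarrow>
          (\<lambda>n. point_set_dist \<kappa> (X n) (T v)) \<longlonglongrightarrow> 0"
      | (H5) "\<forall>z. z \<notin> fixed_points T \<longrightarrow> (INF x. \<kappa> x z + point_set_dist \<kappa> x (T x)) > 0"
      by blast
    then have "v \<in> T v"
    proof cases
      case H1
      then have "closed {(x, y). y \<in> T x}"
        by (simp add: closed_graph_def)
      moreover have "(X n, X (Suc n)) \<in> {(x, y). y \<in> T x}" for n
        using orbit[of n] by simp
      moreover have "(\<lambda>n. (X n, X (Suc n))) \<longlonglongrightarrow> (v, v)"
        using v LIMSEQ_Suc[OF v] by (rule tendsto_Pair)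
      ultimately have "(v, v) \<in> {(x, y). y \<in> T x}"
        by (rule closed_sequentially)
      then show ?thesis by simp
    next
      case H2
      then have "point_set_dist \<kappa> v (T v) \<le> 0"
        by (rule lower_semicontinuous_le_limit[OF _ v step t0])
      then have "point_set_dist \<kappa> v (T v) = 0"
        using point_set_dist_nonneg[of \<kappa> "T v" v, OF nonneg ne] by simp
      then show ?thesis
        by (rule e0_distance_point_set_dist_eq_0_imp_mem[OF kappa closed_T ne])
    next
      case H3
      have "(\<lambda>n. dist (X n) (X (Suc n))) \<longlonglongrightarrow> 0"
        using tendsto_dist[OF v LIMSEQ_Suc[OF v]] by simp
      then have "infdist v (T v) \<le> 0"
        by (rule lower_semicontinuous_le_limit[OF H3 v infdist_le[OF orbit]])
      then have "infdist v (T v) = 0"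
        using infdist_nonneg[of v "T v"] by simp
      then show ?thesis
        using in_closed_iff_infdist_zero[OF closed_T ne] by blast
    next
      case H4
      then have "(\<lambda>n. point_set_dist \<kappa> (X n) (T v)) \<longlonglongrightarrow> 0"
        using orbit v by blast
      then show ?thesis
        by (rule e_distance_limit_in_closed[OF e b0 tail v closed_T ne])
    next
      case H5
      let ?h = "\<lambda>x. \<kappa> x v + point_set_dist \<kappa> x (T x)"
      have "0 \<le> ?h x" for x
        using nonneg point_set_dist_nonneg[of \<kappa>, OF nonneg ne] by (rule add_nonneg_nonneg)
      then have "bdd_below (range ?h)"
        by (intro bdd_belowI2)
      then have "(INF x. ?h x) \<le> ?h (X n)" for n
        by (rule cINF_lower) simp
      then have "(INF x. ?h x) \<le> \<kappa> (X n) v + \<kappa> (X n) (X (Suc n))" for n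
        using add_left_mono[OF step] by (rule order_trans)
      moreover have "(\<lambda>n. \<kappa> (X n) v + \<kappa> (X n) (X (Suc n))) \<longlonglongrightarrow> 0"
        using tendsto_add[OF Xv t0] by simp
      ultimately have "(INF x. ?h x) \<le> 0"
        by (intro LIMSEQ_le_const[of _ 0]) blast+
      with H5 have "v \<in> fixed_points T"
        using not_less by blast
      then show ?thesis
        by (simp add: fixed_points_def)
    qed
    with nofix show False
      by blast
  qed
  then obtain v where "v \<in> T v" ..
  moreover from this S4[of v] have "\<phi> v \<in> T v"
    by blast
  ultimately show ?thesis
    by (auto simp: coincidence_points_def fixed_points_def)
qed

end
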